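(* Let $\psi:\mathcal{H}\to\mathbb{R}$ be of class $C^2$ and bounded below, and assume that $V(x)=\frac12\|\nabla\psi(x)\|^2$ is convex on $\mathcal{H}$. Then $\psi$ is convex.
   Context: $\mathcal{H}$ is a real Hilbert space with norm $\|\cdot\|$; $\nabla$ denotes the gradient. *)

theory Defs
  imports "HOL-Analysis.Analysis"
begin

text \<open>
  Class \<open>C\<^sup>2\<close> in the Frechet sense: the derivatives take their values in the normed spaces of
  bounded linear operators, so \<^term>\<open>f''\<close> is continuous for the operator norm.
\<close>

definition C2 :: "('a::real_normed_vector \<Rightarrow> 'b::real_normed_vector) \<Rightarrow> bool" where
  "C2 f \<longleftrightarrow>
    (\<exists>(f' :: 'a \<Rightarrow> 'a \<Rightarrow>\<^sub>L 'b) (f'' :: 'a \<Rightarrow> 'a \<Rightarrow>\<^sub>L ('a \<Rightarrow>\<^sub>L 'b)).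
      (\<forall>x. (f has_derivative blinfun_apply (f' x)) (at x)) \<and>
      (\<forall>x. (f' has_derivative blinfun_apply (f'' x)) (at x)) \<and>
      continuous_on UNIV f'')"

text \<open>
  The gradient at \<open>x\<close> is the Riesz representative of the Frechet derivative at \<open>x\<close>. In a Hilbert
  space it exists wherever \<open>f\<close> is differentiable; elsewhere the value is unspecified.
\<close>

definition grad :: "('a::real_inner \<Rightarrow> real) \<Rightarrow> 'a \<Rightarrow> 'a" where
  "grad f x = (THE v. GDERIV f x :> v)"

lemma GDERIV_unique:
  assumes "GDERIV f x :> v" and "GDERIV f x :> w"
  shows "v = w"
proof -
  have "(\<lambda>h. inner h v) = (\<lambda>h. inner h w)"
    using assms has_derivative_unique unfolding gderiv_def by blast
  then have "inner (v - w) v = inner (v - w) w" by meson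
  then show ?thesis
    by (metis inner_diff_right inner_eq_zero_iff right_minus_eq)
qed

lemma grad_eqI: "GDERIV f x :> v \<Longrightarrow> grad f x = v"
  unfolding grad_def using GDERIV_unique by blast

end

theory Submission
  imports Defs
begin

text \<open>
  Put \<open>V = \<bar>\<nabla>\<psi>\<bar>\<^sup>2 / 2\<close>. Along the gradient flow \<open>x' = - \<nabla>\<psi>(x)\<close> the potential drops by exactly the action
  \<open>\<integral> \<bar>x'\<bar>\<^sup>2 / 2 + V(x)\<close>, whereas along any other curve Young's inequality bounds the drop by the
  action of that curve. As \<open>V\<close> is convex, so is the action. Run the flow from \<open>a\<close> and from \<open>b\<close>, and
  follow the curve \<open>y = u a + v b\<close> with \<open>u + v = 1\<close>: comparing the three drops shows that the
  convexity defect \<open>\<psi>(u a + v b) - u \<psi>(a) - v \<psi>(b)\<close> cannot decrease in time. So it suffices that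
  the defect becomes arbitrarily small at some later time.

  This is where the lower bound of \<open>\<psi>\<close> enters. It makes \<open>\<integral> \<bar>\<nabla>\<psi>\<bar>\<^sup>2 dt\<close> finite along both
  trajectories. Since \<open>1 / t\<close> is not integrable, there are times \<open>t\<close> at which both squared slopes
  are at most \<open>c / t\<close>, with \<open>c\<close> as small as desired; by convexity of \<open>V\<close> the same then holds on the
  whole segment between the two points. By Cauchy-Schwarz the two points have moved by
  \<open>O(\<surd>t)\<close> only, so the mean value theorem bounds the defect by \<open>\<surd>(c / t) \<sqdot> O(\<surd>t) = O(\<surd>c)\<close>.

  The argument tolerates small errors, so the flow is replaced by Euler polygons and the
  integrals by finite sums. In infinite dimension a continuous gradient need not be uniformly
  continuous on bounded sets, so the step size has to be adapted to the current point. The lemma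
  \<open>adaptive_euler_scheme\<close> shows that such steps can still be chosen so as to reach every time: if
  they were summable, the finite energy would make the scheme converge, and near its limit a step
  of fixed size is admissible. The lemma \<open>defect_step\<close> is the discrete monotonicity of the defect,
  \<open>logarithmic_pigeonhole\<close> finds the time of small slope, and \<open>defect_bound\<close> puts these together.
\<close>

section \<open>Gradients in Hilbert space\<close>

text \<open>
  The representing vector is the minimizer of the energy \<open>J x = \<bar>x\<bar>\<^sup>2 / 2 - f x\<close>. By the
  parallelogram identity minimizing sequences of \<open>J\<close> are Cauchy, so completeness provides the
  minimizer, and vanishing of the first variation of \<open>J\<close> there is the representation of \<open>f\<close>.
\<close>
lemma riesz_representation:
  fixes f :: "'a::{real_inner, complete_space} \<Rightarrow> real"
  assumes "bounded_linear f"
  shows "\<exists>v. \<forall>h. f h = inner h v"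
proof -
  interpret f: bounded_linear f by fact
  define J where "J x = (norm x)\<^sup>2 / 2 - f x" for x
  obtain K where K: "\<And>x. \<bar>f x\<bar> \<le> norm x * K"
    using f.bounded by auto
  have "J x \<ge> - K\<^sup>2 / 2" for x
  proof -
    have "0 \<le> (norm x - K)\<^sup>2" by simp
    then show ?thesis using K[of x] unfolding J_def
      by (simp add: power2_diff abs_le_iff field_simps)
  qed
  then have bdd: "bdd_below (range J)" unfolding bdd_below_def by blast
  define m where "m = Inf (range J)"
  have m_le: "m \<le> J x" for x
    unfolding m_def using bdd by (simp add: cInf_lower)
  have "\<exists>x. J x < m + 1 / real (Suc n)" for n
  proof -
    have "Inf (range J) < m + 1 / real (Suc n)" by (simp add: m_def)
    then show ?thesis
      by (subst (asm) cInf_less_iff) (use bdd in auto)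
  qed
  then obtain X where X: "\<And>n. J (X n) < m + 1 / real (Suc n)" by metis
  have gap: "(dist x y)\<^sup>2 \<le> 4 * (J x + J y - 2 * m)" for x y
  proof -
    have "J ((1/2) *\<^sub>R (x + y)) = (J x + J y) / 2 - (norm (x - y))\<^sup>2 / 8"
      unfolding J_def power2_norm_eq_inner
      by (simp add: f.scaleR f.add inner_add_left inner_add_right inner_diff_left inner_diff_right
          inner_commute[of y x] field_simps)
    with m_le[of "(1/2) *\<^sub>R (x + y)"] show ?thesis
      unfolding dist_norm by argo
  qed
  have "Cauchy X"
    unfolding Cauchy_altdef2
  proof (intro allI impI)
    fix e :: real assume "e > 0"
    then have "e\<^sup>2 / 8 > 0" by simp
    then obtain N where N: "1 / real (Suc N) < e\<^sup>2 / 8"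
      using nat_approx_posE by blast
    have "dist (X n) (X N) < e" if "n \<ge> N" for n
    proof -
      have "1 / real (Suc n) \<le> 1 / real (Suc N)"
        using that by (simp add: frac_le)
      then have "(dist (X n) (X N))\<^sup>2 < e\<^sup>2"
        using gap[of "X n" "X N"] X[of n] X[of N] N by argo
      then show ?thesis using \<open>e > 0\<close> by (meson less_imp_le power2_less_imp_less)
    qed
    then show "\<exists>N. \<forall>n\<ge>N. dist (X n) (X N) < e" by blast
  qed
  then obtain v where v: "X \<longlonglongrightarrow> v"
    using Cauchy_convergent_iff convergent_def by blast
  have "(\<lambda>n. J (X n)) \<longlonglongrightarrow> J v"
    unfolding J_def by (intro tendsto_intros f.tendsto v) simp
  moreover have "(\<lambda>n. m + 1 / real (Suc n)) \<longlonglongrightarrow> m + 0"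
    by (intro tendsto_intros LIMSEQ_Suc lim_1_over_n)
  ultimately have "J v \<le> m + 0"
    by (rule LIMSEQ_le) (use X less_imp_le in blast)
  then have Jmin: "J v \<le> J x" for x using m_le[of x] by simp
  have "f h = inner h v" for h
  proof -
    define q where "q = inner h v - f h"
    have quad: "0 \<le> t * q + t\<^sup>2 * (norm h)\<^sup>2 / 2" for t
    proof -
      have "J (v + t *\<^sub>R h) = J v + (t * q + t\<^sup>2 * (norm h)\<^sup>2 / 2)"
        unfolding J_def q_def power2_norm_eq_inner
        by (simp add: f.scaleR f.add inner_add inner_commute[of v h] field_simps power2_eq_square)
      with Jmin[of "v + t *\<^sub>R h"] show ?thesis by linarith
    qed
    define D where "D = (norm h)\<^sup>2 + 1"
    have D: "D > 0" by (simp add: D_def add_nonneg_pos)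
    \<comment> \<open>The minimizer of the quadratic polynomial with the positive leading coefficient \<open>D / 2\<close>;
      adding 1 to the squared norm covers the case \<open>h = 0\<close>.\<close>
    define s where "s = - q / D"
    have "0 \<le> s * q + s\<^sup>2 * (norm h)\<^sup>2 / 2" by (rule quad)
    also have "\<dots> \<le> s * q + s\<^sup>2 * D / 2"
      by (simp add: D_def field_simps)
    also have "\<dots> = - (q\<^sup>2 / (2 * D))"
      using D unfolding s_def by (simp add: field_simps power2_eq_square)
    finally have "q\<^sup>2 / (2 * D) \<le> 0" by simp
    then have "q = 0" using D by (simp add: divide_le_0_iff)
    then show ?thesis by (simp add: q_def)
  qed
  then show ?thesis by blast
qed

text \<open>
  Completeness is what makes \<^const>\<open>grad\<close> a genuine gradient. It inherits the continuity of the
  Frechet derivative because the Riesz map does not increase distances.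
\<close>
lemma C2_GDERIV_grad:
  fixes f :: "'a::{real_inner, complete_space} \<Rightarrow> real"
  assumes "C2 f"
  shows "GDERIV f x :> grad f x" and "continuous_on UNIV (grad f)"
proof -
  obtain f' :: "'a \<Rightarrow> 'a \<Rightarrow>\<^sub>L real" and f''
    where f': "\<And>x. (f has_derivative blinfun_apply (f' x)) (at x)"
      and f'': "\<And>x. (f' has_derivative blinfun_apply (f'' x)) (at x)"
    using assms unfolding C2_def by blast
  have G: "GDERIV f x :> grad f x" for x
  proof -
    obtain v where "\<And>h. blinfun_apply (f' x) h = inner h v"
      using riesz_representation blinfun.bounded_linear_right by blast
    then have "GDERIV f x :> v"
      using f'[of x] unfolding gderiv_def by presburger
    then show ?thesis by (simp add: grad_eqI)
  qed
  then show "GDERIV f x :> grad f x" .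
  have rep: "blinfun_apply (f' x) h = inner h (grad f x)" for x h
    using has_derivative_unique[OF f'[of x]] G[of x] unfolding gderiv_def by metis
  have lip: "dist (grad f x) (grad f y) \<le> dist (f' x) (f' y)" for x y
  proof -
    define v where "v = grad f x - grad f y"
    have "norm v * norm v = blinfun_apply (f' x - f' y) v"
      by (simp add: blinfun.diff_left rep v_def flip: inner_diff_right power2_eq_square
          power2_norm_eq_inner)
    also have "\<dots> \<le> norm (f' x - f' y) * norm v"
      using norm_blinfun[of "f' x - f' y" v] by simp
    finally have "norm v \<le> norm (f' x - f' y)"
      by (cases "v = 0") auto
    then show ?thesis by (simp add: v_def dist_norm)
  qed
  have "continuous_on UNIV f'"
    by (rule has_derivative_continuous_on[OF f''])
  then show "continuous_on UNIV (grad f)"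
    unfolding continuous_on_iff using le_less_trans[OF lip] by fast
qed

lemma GDERIV_mean_value:
  fixes f :: "'a::real_inner \<Rightarrow> real"
  assumes G: "\<And>x. GDERIV f x :> g x" and "0 \<le> h"
  shows "\<exists>s\<in>{0..h}. f (p - h *\<^sub>R d) - f p = - h * inner (g (p - s *\<^sub>R d)) d"
proof -
  have "\<exists>s\<in>{0..h}. f (p - h *\<^sub>R d) - f (p - 0 *\<^sub>R d)
      = (\<lambda>t. inner (- t *\<^sub>R d) (g (p - s *\<^sub>R d))) (h - 0)"
  proof (rule mvt_very_simple[OF \<open>0 \<le> h\<close>])
    fix s :: real
    have "((\<lambda>s. p - s *\<^sub>R d) has_derivative (\<lambda>t. - t *\<^sub>R d)) (at s within {0..h})"
      by (auto intro!: derivative_eq_intros)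
    from has_derivative_compose[OF this G[of "p - s *\<^sub>R d", unfolded gderiv_def]]
    show "((\<lambda>s. f (p - s *\<^sub>R d)) has_derivative
        (\<lambda>t. inner (- t *\<^sub>R d) (g (p - s *\<^sub>R d)))) (at s within {0..h})" .
  qed
  then show ?thesis by (simp add: inner_commute)
qed

text \<open>
  Without local compactness, only the continuity of \<open>g\<close> at the single point \<open>p w\<close> is available; it
  gives one step size \<open>\<eta>\<close> that serves for all \<open>z\<close> close to \<open>w\<close>. Base point and direction depend on a
  parameter \<open>z\<close> so that the lemma applies to both trajectories and to their convex combination.
\<close>
lemma first_order_expansion_locally_uniform:
  fixes f :: "'a::real_inner \<Rightarrow> real" and p d :: "'b::topological_space \<Rightarrow> 'a"
  assumes G: "\<And>x. GDERIV f x :> g x" and g: "continuous_on UNIV g"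
    and p: "continuous_on UNIV p" and d: "continuous_on UNIV d" and "0 < e"
  shows "\<exists>\<eta>>0. \<forall>\<^sub>F z in nhds w. \<forall>h. 0 < h \<longrightarrow> h \<le> \<eta> \<longrightarrow>
    \<bar>f (p z - h *\<^sub>R d z) - f (p z) + h * inner (g (p z)) (d z)\<bar> \<le> h * e"
proof -
  define E where "E = (\<lambda>(z, s :: real). inner (g (p z - s *\<^sub>R d z) - g (p z)) (d z))"
  have "continuous_on UNIV E"
    unfolding E_def case_prod_unfold
    by (intro continuous_intros continuous_on_compose2[OF g] continuous_on_compose2[OF p]
        continuous_on_compose2[OF d]) auto
  then have "E \<midarrow>(w, 0)\<rightarrow> E (w, 0)"
    by (simp add: continuous_on_def)
  then have "(E \<longlongrightarrow> E (w, 0)) (nhds (w, 0))"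
    by (simp add: tendsto_at_iff_tendsto_nhds)
  moreover have "E (w, 0) = 0" by (simp add: E_def)
  ultimately have "\<forall>\<^sub>F x in nhds (w, 0). dist (E x) 0 < e"
    using \<open>0 < e\<close> by (auto dest: tendstoD)
  then have "\<forall>\<^sub>F x in nhds w \<times>\<^sub>F nhds 0. \<bar>E x\<bar> < e"
    by (simp add: nhds_prod)
  then obtain P Q where P: "eventually P (nhds w)" and Q: "eventually Q (nhds (0::real))"
    and PQ: "\<And>z s. P z \<Longrightarrow> Q s \<Longrightarrow> \<bar>E (z, s)\<bar> < e"
    unfolding eventually_prod_filter by blast
  obtain r where "r > 0" and r: "\<And>s. dist s 0 < r \<Longrightarrow> Q s"
    using Q unfolding eventually_nhds_metric by blast
  have "\<bar>f (p z - h *\<^sub>R d z) - f (p z) + h * inner (g (p z)) (d z)\<bar> \<le> h * e"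
    if "P z" "0 < h" "h \<le> r / 2" for z h
  proof -
    obtain s where s: "s \<in> {0..h}"
      "f (p z - h *\<^sub>R d z) - f (p z) = - h * inner (g (p z - s *\<^sub>R d z)) (d z)"
      using GDERIV_mean_value[OF G less_imp_le[OF \<open>0 < h\<close>]] by blast
    have "Q s" using r s(1) that \<open>r > 0\<close> by auto
    then have "\<bar>E (z, s)\<bar> < e" using PQ \<open>P z\<close> by blast
    moreover have "f (p z - h *\<^sub>R d z) - f (p z) + h * inner (g (p z)) (d z) = - h * E (z, s)"
      unfolding s(2) E_def by (simp add: inner_diff_left algebra_simps)
    ultimately show ?thesis using \<open>0 < h\<close> by (simp add: abs_mult)
  qed
  then have "\<forall>\<^sub>F z in nhds w. \<forall>h. 0 < h \<longrightarrow> h \<le> r/2 \<longrightarrow>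
    \<bar>f (p z - h *\<^sub>R d z) - f (p z) + h * inner (g (p z)) (d z)\<bar> \<le> h * e"
    using P by (auto elim: eventually_mono)
  then show ?thesis using \<open>r > 0\<close> by (intro exI[of _ "r/2"]) auto
qed

section \<open>Adaptive Euler schemes\<close>

text \<open>
  Here \<open>A z h\<close> means that the step \<open>h\<close> is admissible at \<open>z\<close>, and \<open>W\<close> is an energy which admissible
  steps dissipate. Every step is chosen greedily: no admissible step in \<open>(0, 1]\<close> exceeds twice its
  length. If the steps were summable, then by the energy estimate so would be the displacements
  \<open>h \<bar>G\<bar> \<le> h + h \<bar>G\<bar>\<^sup>2\<close>, and the points would converge to some \<open>y\<close>. Near \<open>y\<close> one fixed step \<open>\<eta>\<close>
  is admissible, so greed forces the steps to stay above \<open>\<eta> / 2\<close>: a contradiction.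
\<close>
lemma adaptive_euler_scheme:
  fixes G :: "'b::{real_normed_vector, complete_space} \<Rightarrow> 'b" and W :: "'b \<Rightarrow> real"
  assumes loc: "\<And>z. \<exists>\<eta>>0. \<eta> \<le> 1 \<and> (\<forall>\<^sub>F w in nhds z. A w \<eta>)"
    and decr: "\<And>z h. A z h \<Longrightarrow> 0 < h \<Longrightarrow> h * (norm (G z))\<^sup>2 \<le> W z - W (z - h *\<^sub>R G z) + K * h"
    and bdd: "\<And>z. m \<le> W z"
  obtains z :: "nat \<Rightarrow> 'b" and h :: "nat \<Rightarrow> real"
  where "z 0 = z0" and "\<And>n. 0 < h n" and "\<And>n. h n \<le> 1" and "\<And>n. A (z n) (h n)"
    and "\<And>n. z (Suc n) = z n - h n *\<^sub>R G (z n)" and "\<not> summable h"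
proof -
  have "\<exists>h>0. h \<le> 1 \<and> A z h \<and> (\<forall>k. 0 < k \<longrightarrow> k \<le> 1 \<longrightarrow> A z k \<longrightarrow> k \<le> 2 * h)" for z
  proof -
    define S where "S = {h. 0 < h \<and> h \<le> 1 \<and> A z h}"
    obtain \<eta> where eta: "\<eta> > 0" "\<eta> \<le> 1" "A z \<eta>"
      using loc[of z] eventually_nhds_x_imp_x by blast
    have bd: "bdd_above S" unfolding S_def by (rule bdd_aboveI[of _ 1]) auto
    have up: "k \<le> Sup S" if "k \<in> S" for k using bd that by (rule cSup_upper[rotated])
    have "\<eta> \<in> S" using eta by (simp add: S_def)
    then have "Sup S / 2 < Sup S" using up[of \<eta>] eta by linarith
    then obtain h where "h \<in> S" "Sup S / 2 < h"
      using less_cSup_iff[OF _ bd] \<open>\<eta> \<in> S\<close> by (metis empty_iff)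
    then have "\<forall>k\<in>S. k \<le> 2 * h" using up by fastforce
    then show ?thesis using \<open>h \<in> S\<close> unfolding S_def by blast
  qed
  then obtain step where step: "\<And>z. 0 < step z" "\<And>z. step z \<le> 1" "\<And>z. A z (step z)"
    "\<And>z k. 0 < k \<Longrightarrow> k \<le> 1 \<Longrightarrow> A z k \<Longrightarrow> k \<le> 2 * step z" by metis
  define z where "z = rec_nat z0 (\<lambda>n x. x - step x *\<^sub>R G x)"
  have z0: "z 0 = z0" and zS: "z (Suc n) = z n - step (z n) *\<^sub>R G (z n)" for n
    by (simp_all add: z_def)
  define h where "h n = step (z n)" for n
  have h0: "0 < h n" for n by (simp add: h_def step)
  have "\<not> summable h"
  proof
    assume sm: "summable h"
    \<comment> \<open>Telescoped dissipation, with an error proportional to the elapsed time.\<close>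
    have en: "(\<Sum>k<n. h k * (norm (G (z k)))\<^sup>2) \<le> W z0 - W (z n) + K * (\<Sum>k<n. h k)" for n
    proof (induction n)
      case 0 then show ?case by (simp add: z0)
    next
      case (Suc n)
      then show ?case using decr[OF step(3) step(1), of "z n"]
        by (simp add: zS h_def algebra_simps)
    qed
    have part: "(\<Sum>k<n. h k) \<le> suminf h" for n
      by (rule sum_le_suminf[OF sm]) (use h0 less_imp_le in auto)
    have hn: "0 \<le> (\<Sum>k<n. h k)" for n by (simp add: h0 less_imp_le sum_nonneg)
    have sq: "summable (\<lambda>k. h k * (norm (G (z k)))\<^sup>2)"
    proof (rule summableI_nonneg_bounded)
      fix n
      have "K * (\<Sum>k<n. h k) \<le> \<bar>K\<bar> * suminf h"
        by (meson abs_ge_self abs_ge_zero hn mult_mono order_trans part)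
      then show "(\<Sum>k<n. h k * (norm (G (z k)))\<^sup>2) \<le> W z0 - m + \<bar>K\<bar> * suminf h"
        using en[of n] bdd[of "z n"] by linarith
    qed (simp add: h0 less_imp_le)
    define c where "c k = norm (z (Suc k) - z k)" for k
    have c_le: "c k \<le> h k + h k * (norm (G (z k)))\<^sup>2" for k
    proof -
      have "norm (G (z k)) \<le> 1 + (norm (G (z k)))\<^sup>2"
        using sum_squares_bound[of "norm (G (z k))" 1] norm_ge_zero[of "G (z k)"]
        by (simp only: mult_1_right power_one)
      then have "h k * norm (G (z k)) \<le> h k * (1 + (norm (G (z k)))\<^sup>2)"
        by (intro mult_left_mono) (use h0 less_imp_le in auto)
      then show ?thesis by (simp add: c_def zS h_def[symmetric] h0 less_imp_le algebra_simps)
    qed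
    have "summable c"
      by (rule summable_comparison_test'[OF summable_add[OF sm sq], of 0])
        (use c_le in \<open>auto simp: c_def\<close>)
    then have cau: "Cauchy (\<lambda>n. \<Sum>k<n. c k)"
      by (rule LIMSEQ_imp_Cauchy[OF summable_LIMSEQ])
    have tri: "dist (z n) (z N) \<le> dist (\<Sum>k<n. c k) (\<Sum>k<N. c k)" if "n \<ge> N" for n N
      using that
    proof (induction n rule: dec_induct)
      case base then show ?case by simp
    next
      case (step n)
      have "(\<Sum>k<N. c k) \<le> (\<Sum>k<n. c k)"
        by (rule sum_mono2) (use step in \<open>auto simp: c_def\<close>)
      moreover have "dist (z (Suc n)) (z N) \<le> c n + dist (z n) (z N)"
        by (metis c_def dist_norm dist_triangle)
      moreover have "0 \<le> c n" by (simp add: c_def)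
      ultimately show ?case using step.IH by (simp add: dist_real_def)
    qed
    have "Cauchy z"
      using cau tri unfolding Cauchy_altdef2 by (meson le_less_trans)
    then obtain y where y: "z \<longlonglongrightarrow> y"
      using Cauchy_convergent_iff convergent_def by blast
    obtain \<eta> where eta: "\<eta> > 0" "\<eta> \<le> 1" "\<forall>\<^sub>F w in nhds y. A w \<eta>" using loc by blast
    have "\<forall>\<^sub>F n in sequentially. A (z n) \<eta>"
      using filterlim_iff[THEN iffD1, OF y] eta(3) by blast
    then have "\<forall>\<^sub>F n in sequentially. \<eta> / 2 \<le> h n"
      by eventually_elim (use step(4)[OF eta(1,2)] in \<open>force simp: h_def\<close>)
    moreover have "\<forall>\<^sub>F n in sequentially. h n < \<eta> / 2"
      using summable_LIMSEQ_zero[OF sm] eta(1) by (intro order_tendstoD) auto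
    ultimately have "\<forall>\<^sub>F n in sequentially. False" by eventually_elim linarith
    then show False by simp
  qed
  then show ?thesis using that[of z h] z0 zS h0 step by (simp add: h_def)
qed

text \<open>
  With \<open>t\<^sub>k\<close> the time before step \<open>k\<close>, the sum of \<open>h\<^sub>k / (1 + t\<^sub>k)\<close> is an upper Riemann sum for the
  integral of \<open>1 / (1 + t)\<close>, hence at least \<open>ln (1 + t\<^sub>N)\<close>. So \<open>q\<close> cannot stay above \<open>c / (1 + t)\<close>
  all the time.
\<close>
lemma logarithmic_pigeonhole:
  fixes h q :: "nat \<Rightarrow> real"
  assumes h: "\<And>n. 0 < h n" and c: "0 < c"
    and less: "(\<Sum>k<N. h k * q k) < c * ln (1 + (\<Sum>k<N. h k))"
  shows "\<exists>k<N. q k < c / (1 + (\<Sum>j<k. h j))"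
proof (rule ccontr)
  assume "\<not> ?thesis"
  then have ge: "c / (1 + (\<Sum>j<k. h j)) \<le> q k" if "k < N" for k using that by force
  have "c * ln (1 + (\<Sum>k<n. h k)) \<le> (\<Sum>k<n. h k * q k)" if "n \<le> N" for n
    using that
  proof (induction n)
    case 0 then show ?case by simp
  next
    case (Suc n)
    define t where "t = 1 + (\<Sum>k<n. h k)"
    have t: "t > 0" unfolding t_def by (simp add: add_pos_nonneg h less_imp_le sum_nonneg)
    have "ln (t + h n) = ln t + ln (1 + h n / t)"
    proof -
      have "t + h n = t * (1 + h n / t)" using t by (simp add: field_simps)
      then show ?thesis using t h[of n]
        by (metis add_pos_pos divide_pos_pos ln_mult_pos zero_less_one)
    qed
    also have "\<dots> \<le> ln t + h n / t"
      using ln_add_one_self_le_self[of "h n / t"] t h[of n] by simp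
    finally have "c * ln (t + h n) \<le> c * ln t + h n * (c / t)"
      using c mult_left_mono[of "ln (t + h n)" "ln t + h n / t" c] by (simp add: algebra_simps)
    moreover have "h n * (c / t) \<le> h n * q n"
      using ge[of n] Suc.prems h[of n] by (intro mult_left_mono) (auto simp: t_def)
    ultimately show ?case using Suc by (simp add: t_def algebra_simps)
  qed
  from this[of N] less show False by simp
qed

text \<open>
  This is the Cauchy-Schwarz bound of the displacement by the geometric mean of time and energy,
  in the form of an arithmetic mean with a free weight \<open>a\<close>, in which each step is estimated
  separately. The weight \<open>a = \<surd>(1 + t)\<close> will give displacement \<open>O(\<surd>t)\<close> at time \<open>t\<close>.
\<close>
lemma scheme_displacement:
  fixes z :: "nat \<Rightarrow> 'b::real_normed_vector"
  assumes "\<And>n. 0 < h n" and z: "\<And>n. z (Suc n) = z n - h n *\<^sub>R G n" and a: "0 < a"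
  shows "norm (z n - z 0) \<le> ((\<Sum>k<n. h k) / a + a * (\<Sum>k<n. h k * (norm (G k))\<^sup>2)) / 2"
proof (induction n)
  case 0 then show ?case by simp
next
  case (Suc n)
  have eq: "z (Suc n) - z 0 = (z n - z 0) - h n *\<^sub>R G n" by (simp add: z)
  have "norm (z (Suc n) - z 0) \<le> norm (z n - z 0) + h n * norm (G n)"
    using norm_triangle_ineq4[of "z n - z 0" "h n *\<^sub>R G n"] assms(1)[of n] unfolding eq by simp
  moreover have "norm (G n) \<le> (1 / a + a * (norm (G n))\<^sup>2) / 2"
  proof -
    have "0 \<le> (a * norm (G n) - 1)\<^sup>2 / a" using a by simp
    also have "\<dots> = a * (norm (G n))\<^sup>2 - 2 * norm (G n) + 1 / a"
      using a by (simp add: power2_diff field_simps power2_eq_square)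
    finally show ?thesis by simp
  qed
  then have "h n * norm (G n) \<le> h n * ((1 / a + a * (norm (G n))\<^sup>2) / 2)"
    using assms(1)[of n] by simp
  ultimately show ?case using Suc by (simp add: algebra_simps add_divide_distrib)
qed

section \<open>Potentials whose squared slope is convex\<close>

locale convex_slope_potential =
  fixes \<psi> :: "'a::{real_inner, complete_space} \<Rightarrow> real" and g :: "'a \<Rightarrow> 'a" and m :: real
  assumes GDERIV_\<psi>: "GDERIV \<psi> x :> g x"
    and continuous_g: "continuous_on UNIV g"
    and \<psi>_ge: "m \<le> \<psi> x"
    and convex_V: "convex_on UNIV (\<lambda>x. (1/2) * (norm (g x))\<^sup>2)"
begin

definition defect :: "real \<Rightarrow> real \<Rightarrow> 'a \<times> 'a \<Rightarrow> real" where
  "defect u v z = \<psi> (u *\<^sub>R fst z + v *\<^sub>R snd z) - (u * \<psi> (fst z) + v * \<psi> (snd z))"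

text \<open>
  The gradient of \<open>(a, b) \<mapsto> \<psi> a + \<psi> b\<close>. Both trajectories form a single gradient descent in the
  product space, so that they share their time grid.
\<close>
definition pair_g :: "'a \<times> 'a \<Rightarrow> 'a \<times> 'a" where
  "pair_g z = (g (fst z), g (snd z))"

text \<open>
  The first-order expansion of \<open>\<psi>\<close> has error at most \<open>h \<epsilon>\<close> along the Euler step of each of the two
  points and along the step which these induce on the convex combination. This last step is
  in general not in the direction of the gradient.
\<close>
definition small_step :: "real \<Rightarrow> real \<Rightarrow> real \<Rightarrow> 'a \<times> 'a \<Rightarrow> real \<Rightarrow> bool" where
  "small_step u v \<epsilon> z h \<longleftrightarrow>
    (\<forall>(p, d) \<in> {(fst z, g (fst z)), (snd z, g (snd z)),
        (u *\<^sub>R fst z + v *\<^sub>R snd z, u *\<^sub>R g (fst z) + v *\<^sub>R g (snd z))}.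
      \<bar>\<psi> (p - h *\<^sub>R d) - \<psi> p + h * inner (g p) d\<bar> \<le> h * \<epsilon>)"

lemma slope_sq_convex:
  assumes "0 \<le> u" "0 \<le> v" "u + v = 1"
  shows "(norm (g (u *\<^sub>R a + v *\<^sub>R b)))\<^sup>2 \<le> u * (norm (g a))\<^sup>2 + v * (norm (g b))\<^sup>2"
proof -
  have "(1/2) * (norm (g (u *\<^sub>R a + v *\<^sub>R b)))\<^sup>2
      \<le> u * ((1/2) * (norm (g a))\<^sup>2) + v * ((1/2) * (norm (g b))\<^sup>2)"
    using convex_V assms unfolding convex_on_def by blast
  then show ?thesis by simp
qed

lemma norm_pair_g: "(norm (pair_g z))\<^sup>2 = (norm (g (fst z)))\<^sup>2 + (norm (g (snd z)))\<^sup>2"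
  by (simp add: pair_g_def norm_Pair)

lemma small_step_locally_uniform:
  assumes "0 < \<epsilon>"
  shows "\<exists>\<eta>>0. \<eta> \<le> 1 \<and> (\<forall>\<^sub>F z in nhds w. small_step u v \<epsilon> z \<eta>)"
proof -
  note ex = first_order_expansion_locally_uniform[OF GDERIV_\<psi> continuous_g _ _ assms, where w = w]
  have cont: "continuous_on UNIV (fst :: 'a \<times> 'a \<Rightarrow> 'a)" "continuous_on UNIV (snd :: 'a \<times> 'a \<Rightarrow> 'a)"
    by (intro continuous_intros)+
  then have contg: "continuous_on UNIV (\<lambda>z :: 'a \<times> 'a. g (fst z))"
    "continuous_on UNIV (\<lambda>z :: 'a \<times> 'a. g (snd z))"
    by (intro continuous_on_compose2[OF continuous_g]; simp)+
  obtain \<eta>1 where e1: "\<eta>1 > 0" "\<forall>\<^sub>F z in nhds w. \<forall>h. 0 < h \<longrightarrow> h \<le> \<eta>1 \<longrightarrow>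
    \<bar>\<psi> (fst z - h *\<^sub>R g (fst z)) - \<psi> (fst z) + h * inner (g (fst z)) (g (fst z))\<bar> \<le> h * \<epsilon>"
    using ex[OF cont(1) contg(1)] by blast
  obtain \<eta>2 where e2: "\<eta>2 > 0" "\<forall>\<^sub>F z in nhds w. \<forall>h. 0 < h \<longrightarrow> h \<le> \<eta>2 \<longrightarrow>
    \<bar>\<psi> (snd z - h *\<^sub>R g (snd z)) - \<psi> (snd z) + h * inner (g (snd z)) (g (snd z))\<bar> \<le> h * \<epsilon>"
    using ex[OF cont(2) contg(2)] by blast
  define p where "p z = u *\<^sub>R fst z + v *\<^sub>R snd z" for z :: "'a \<times> 'a"
  define d where "d z = u *\<^sub>R g (fst z) + v *\<^sub>R g (snd z)" for z :: "'a \<times> 'a"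
  have "continuous_on UNIV p" "continuous_on UNIV d"
    unfolding p_def d_def by (intro continuous_on_add continuous_on_scaleR continuous_on_const cont contg)+
  from ex[OF this] obtain \<eta>3 where e3: "\<eta>3 > 0" "\<forall>\<^sub>F z in nhds w. \<forall>h. 0 < h \<longrightarrow> h \<le> \<eta>3 \<longrightarrow>
    \<bar>\<psi> (p z - h *\<^sub>R d z) - \<psi> (p z) + h * inner (g (p z)) (d z)\<bar> \<le> h * \<epsilon>"
    by blast
  define \<eta> where "\<eta> = min (min \<eta>1 \<eta>2) (min \<eta>3 1)"
  have eta: "\<eta> > 0" "\<eta> \<le> 1" "\<eta> \<le> \<eta>1" "\<eta> \<le> \<eta>2" "\<eta> \<le> \<eta>3"
    using e1 e2 e3 by (auto simp: \<eta>_def)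
  have "\<forall>\<^sub>F z in nhds w. small_step u v \<epsilon> z \<eta>"
    using e1(2) e2(2) e3(2)
    by eventually_elim (simp add: small_step_def eta flip: p_def d_def)
  then show ?thesis using eta by blast
qed

lemma small_step_dissipation:
  assumes "small_step u v \<epsilon> z h"
  shows "h * (norm (g (fst z)))\<^sup>2 \<le> \<psi> (fst z) - \<psi> (fst (z - h *\<^sub>R pair_g z)) + h * \<epsilon>"
    and "h * (norm (g (snd z)))\<^sup>2 \<le> \<psi> (snd z) - \<psi> (snd (z - h *\<^sub>R pair_g z)) + h * \<epsilon>"
  using assms unfolding small_step_def pair_g_def power2_norm_eq_inner by auto

text \<open>
  On the step of the combined point \<open>y\<close>, in direction \<open>d = u \<nabla>\<psi>(a) + v \<nabla>\<psi>(b)\<close>, the potential drops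
  by about \<open>h \<langle>\<nabla>\<psi>(y), d\<rangle> \<le> h (\<bar>\<nabla>\<psi>(y)\<bar>\<^sup>2 + \<bar>d\<bar>\<^sup>2) / 2\<close>. Both squares are at most
  \<open>u \<bar>\<nabla>\<psi>(a)\<bar>\<^sup>2 + v \<bar>\<nabla>\<psi>(b)\<bar>\<^sup>2\<close>, the first one by convexity of \<open>V\<close> and the second one by convexity of
  the squared norm, and \<open>h\<close> times this is about the averaged drop of \<open>\<psi>\<close> at \<open>a\<close> and \<open>b\<close>.
\<close>
lemma defect_step:
  assumes A: "small_step u v \<epsilon> z h" and "0 \<le> h" and uv: "0 \<le> u" "0 \<le> v" "u + v = 1"
  shows "defect u v z \<le> defect u v (z - h *\<^sub>R pair_g z) + 2 * \<epsilon> * h"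
proof -
  define a b where "a = fst z" and "b = snd z"
  define y where "y = u *\<^sub>R a + v *\<^sub>R b"
  define d where "d = u *\<^sub>R g a + v *\<^sub>R g b"
  have y': "u *\<^sub>R fst (z - h *\<^sub>R pair_g z) + v *\<^sub>R snd (z - h *\<^sub>R pair_g z) = y - h *\<^sub>R d"
    by (simp add: y_def d_def a_def b_def pair_g_def algebra_simps)
  have "\<psi> y - \<psi> (y - h *\<^sub>R d) \<le> h * inner (g y) d + h * \<epsilon>"
    using A unfolding small_step_def y_def d_def a_def b_def by auto
  moreover have "inner (g y) d \<le> u * (norm (g a))\<^sup>2 + v * (norm (g b))\<^sup>2"
  proof -
    have "inner (g y) d \<le> ((norm (g y))\<^sup>2 + (norm d)\<^sup>2) / 2"
      using norm_cauchy_schwarz[of "g y" d] sum_squares_bound[of "norm (g y)" "norm d"] by argo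
    moreover have "(norm (g y))\<^sup>2 \<le> u * (norm (g a))\<^sup>2 + v * (norm (g b))\<^sup>2"
      unfolding y_def by (rule slope_sq_convex[OF uv])
    moreover have "(norm d)\<^sup>2 \<le> u * (norm (g a))\<^sup>2 + v * (norm (g b))\<^sup>2"
    proof -
      have u: "u = 1 - v" using uv by simp
      have "u * (norm (g a))\<^sup>2 + v * (norm (g b))\<^sup>2 - (norm d)\<^sup>2
          = u * v * (norm (g a - g b))\<^sup>2"
        unfolding d_def power2_norm_eq_inner u
        by (simp add: inner_add_left inner_add_right inner_diff_left inner_diff_right
            inner_commute[of "g b" "g a"] algebra_simps)
      moreover have "0 \<le> u * v * (norm (g a - g b))\<^sup>2" using uv by simp
      ultimately show ?thesis by linarith
    qed
    ultimately show ?thesis by argo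
  qed
  then have "h * inner (g y) d \<le> u * (h * (norm (g a))\<^sup>2) + v * (h * (norm (g b))\<^sup>2)"
    using mult_left_mono[OF _ \<open>0 \<le> h\<close>] by (fastforce simp: algebra_simps)
  moreover have "u * (h * (norm (g a))\<^sup>2)
      \<le> u * (\<psi> a - \<psi> (fst (z - h *\<^sub>R pair_g z)) + h * \<epsilon>)"
    unfolding a_def by (intro mult_left_mono small_step_dissipation(1)[OF A] uv)
  moreover have "v * (h * (norm (g b))\<^sup>2)
      \<le> v * (\<psi> b - \<psi> (snd (z - h *\<^sub>R pair_g z)) + h * \<epsilon>)"
    unfolding b_def by (intro mult_left_mono small_step_dissipation(2)[OF A] uv)
  moreover have "u * (h * \<epsilon>) + v * (h * \<epsilon>) = h * \<epsilon>"
    using uv(3) by (metis distrib_right mult_1)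
  ultimately show ?thesis
    unfolding defect_def y' y_def[symmetric] a_def[symmetric] b_def[symmetric]
    by (simp add: algebra_simps)
qed

text \<open>
  By convexity of \<open>V\<close>, a bound of the slope at the endpoints holds on the whole segment, and the
  mean value theorem compares the potential at the intermediate point with its values at the ends.
\<close>
lemma defect_le_slope_times_distance:
  assumes uv: "0 \<le> u" "0 \<le> v" "u + v = 1"
    and ga: "(norm (g a))\<^sup>2 \<le> s" and gb: "(norm (g b))\<^sup>2 \<le> s"
  shows "defect u v (a, b) \<le> sqrt s * norm (a - b)"
proof -
  define y where "y = u *\<^sub>R a + v *\<^sub>R b"
  have s: "0 \<le> sqrt s" using ga by (meson order_trans real_sqrt_ge_zero zero_le_power2)
  have slope: "norm (g x) \<le> sqrt s" if x: "x \<in> closed_segment a b" for x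
  proof -
    obtain q where q: "0 \<le> q" "q \<le> 1" "x = (1 - q) *\<^sub>R a + q *\<^sub>R b"
      using x unfolding in_segment(1) by blast
    define p where "p = 1 - q"
    have pq: "0 \<le> p" "0 \<le> q" "p + q = 1" "x = p *\<^sub>R a + q *\<^sub>R b"
      using q by (auto simp: p_def)
    have "(norm (g x))\<^sup>2 \<le> p * (norm (g a))\<^sup>2 + q * (norm (g b))\<^sup>2"
      unfolding pq(4) by (rule slope_sq_convex[OF pq(1-3)])
    also have "\<dots> \<le> p * s + q * s"
      by (intro add_mono mult_left_mono pq ga gb)
    also have "\<dots> = s" using pq(3) by (metis distrib_right mult_1)
    finally show ?thesis by (simp add: real_le_rsqrt)
  qed
  have mv: "\<psi> y - \<psi> x \<le> sqrt s * norm (y - x)"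
    if x: "x \<in> closed_segment a b" and y: "y \<in> closed_segment a b" for x
  proof -
    have "norm (\<psi> y - \<psi> x) \<le> sqrt s * norm (y - x)"
    proof (rule differentiable_bound[OF convex_closed_segment _ _ y x])
      fix w assume w: "w \<in> closed_segment a b"
      show "(\<psi> has_derivative (\<lambda>k. inner k (g w))) (at w within closed_segment a b)"
        using GDERIV_\<psi>[of w] unfolding gderiv_def by (rule has_derivative_at_withinI)
      show "onorm (\<lambda>k. inner k (g w)) \<le> sqrt s"
      proof (rule onorm_bound[OF s])
        fix k
        have "norm (inner k (g w)) \<le> norm k * norm (g w)"
          by (simp add: Cauchy_Schwarz_ineq2)
        also have "\<dots> \<le> norm k * sqrt s" by (intro mult_left_mono slope w) auto
        finally show "norm (inner k (g w)) \<le> sqrt s * norm k" by (simp add: mult.commute)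
      qed
    qed
    then show ?thesis by simp
  qed
  have u: "u = 1 - v" using uv by simp
  have y: "y \<in> closed_segment a b"
    unfolding closed_segment_def y_def using uv u by auto
  have ya: "y - a = v *\<^sub>R (b - a)" and yb: "y - b = u *\<^sub>R (a - b)"
    unfolding y_def u by (simp_all add: algebra_simps)
  have "\<psi> y - \<psi> a \<le> sqrt s * (v * norm (a - b))"
    using mv[of a] y uv by (simp add: ya norm_minus_commute)
  also have "\<dots> \<le> sqrt s * norm (a - b)"
    using uv s by (intro mult_left_mono mult_left_le_one_le) auto
  finally have 1: "\<psi> y - \<psi> a \<le> sqrt s * norm (a - b)" .
  have "\<psi> y - \<psi> b \<le> sqrt s * (u * norm (a - b))"
    using mv[of b] y uv by (simp add: yb)
  also have "\<dots> \<le> sqrt s * norm (a - b)"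
    using uv s by (intro mult_left_mono mult_left_le_one_le) auto
  finally have 2: "\<psi> y - \<psi> b \<le> sqrt s * norm (a - b)" .
  have "defect u v (a, b) = u * (\<psi> y - \<psi> a) + v * (\<psi> y - \<psi> b)"
    unfolding defect_def y_def[symmetric] fst_conv snd_conv u by (simp add: y_def u algebra_simps)
  also have "\<dots> \<le> u * (sqrt s * norm (a - b)) + v * (sqrt s * norm (a - b))"
    by (intro add_mono mult_left_mono 1 2 uv)
  also have "\<dots> = sqrt s * norm (a - b)" using uv(3) by (metis distrib_right mult_1)
  finally show ?thesis .
qed

text \<open>
  The factor of \<open>\<surd>c\<close> does not depend on \<open>c\<close>, so letting \<open>c\<close> tend to 0 yields convexity. Here \<open>c\<close>
  is the constant in the slope bound \<open>c / (1 + t)\<close>, which is attained before a time horizon \<open>T\<close>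
  that is exponential in \<open>1 / c\<close>.
\<close>
lemma defect_bound:
  assumes uv: "0 \<le> u" "0 \<le> v" "u + v = 1" and c: "0 < c"
  shows "defect u v (a, b) \<le> sqrt c * (norm (a - b) + (\<psi> a + \<psi> b - 2 * m) + 3) + 2 * c"
proof -
  define E where "E = \<psi> a + \<psi> b - 2 * m"
  have E: "0 \<le> E" using \<psi>_ge[of a] \<psi>_ge[of b] by (simp add: E_def)
  \<comment> \<open>The dissipated energy is at most \<open>E + 2\<close>; this \<open>T\<close> makes \<open>c ln (1 + T)\<close> larger than that.\<close>
  define T where "T = exp ((E + 3) / c)"
  have T: "0 < T" by (simp add: T_def)
  \<comment> \<open>Steps have length at most 1, so the first time past \<open>T\<close> is at most \<open>T + 1\<close>, and the errors
    accumulated until then are at most a multiple of both \<open>c\<close> and 1.\<close>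
  define \<epsilon> where "\<epsilon> = min c 1 / (T + 1)"
  have eps: "0 < \<epsilon>" using c T by (simp add: \<epsilon>_def)
  define W where "W z = \<psi> (fst z) + \<psi> (snd z)" for z
  have decr: "h * (norm (pair_g z))\<^sup>2 \<le> W z - W (z - h *\<^sub>R pair_g z) + (2 * \<epsilon>) * h"
    if "small_step u v \<epsilon> z h" for z h
    using small_step_dissipation[OF that] by (simp add: W_def norm_pair_g algebra_simps)
  have W: "2 * m \<le> W z" for z using \<psi>_ge[of "fst z"] \<psi>_ge[of "snd z"] by (simp add: W_def)
  obtain z h where z0: "z 0 = (a, b)" and h: "\<And>n. 0 < h n" "\<And>n. h n \<le> 1"
    and A: "\<And>n. small_step u v \<epsilon> (z n) (h n)"
    and zS: "\<And>n. z (Suc n) = z n - h n *\<^sub>R pair_g (z n)" and div: "\<not> summable h"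
    using adaptive_euler_scheme[where A = "small_step u v \<epsilon>" and G = pair_g and W = W
        and m = "2 * m" and K = "2 * \<epsilon>" and ?z0.0 = "(a, b)",
        OF small_step_locally_uniform[OF eps] decr W] by blast
  define t where "t n = (\<Sum>k<n. h k)" for n
  define S where "S n = (\<Sum>k<n. h k * (norm (pair_g (z k)))\<^sup>2)" for n
  have t: "0 \<le> t n" for n by (simp add: t_def h less_imp_le sum_nonneg)
  have S: "S n \<le> E + 2 * \<epsilon> * t n" for n
  proof -
    have "S n \<le> W (a, b) - W (z n) + 2 * \<epsilon> * t n"
    proof (induction n)
      case 0 then show ?case by (simp add: S_def t_def z0)
    next
      case (Suc n)
      then show ?case using decr[OF A[of n]] by (simp add: S_def t_def zS algebra_simps)
    qed
    then show ?thesis using W[of "z n"] by (simp add: W_def E_def)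
  qed
  have D: "defect u v (a, b) \<le> defect u v (z n) + 2 * \<epsilon> * t n" for n
  proof (induction n)
    case 0 then show ?case by (simp add: t_def z0)
  next
    case (Suc n)
    then show ?case using defect_step[OF A[of n] less_imp_le[OF h(1)] uv]
      by (simp add: t_def zS algebra_simps)
  qed
  have "\<exists>N. T \<le> t N"
  proof (rule ccontr)
    assume "\<not> ?thesis"
    then have "summable h"
      by (intro summableI_nonneg_bounded[of _ T]) (auto simp: t_def h less_imp_le not_le)
    with div show False by simp
  qed
  then obtain N where N: "T \<le> t N" and before: "\<And>n. n < N \<Longrightarrow> t n < T"
    using exists_least_iff[of "\<lambda>N. T \<le> t N"] by (auto simp: not_le)
  have "t N \<le> T + 1"
  proof (cases N)
    case 0 then show ?thesis using T by (simp add: t_def)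
  next
    case (Suc n) then show ?thesis using before[of n] h(2)[of n] by (simp add: t_def)
  qed
  then have small: "\<epsilon> * t n \<le> min c 1" if "n \<le> N" for n
  proof -
    have "t n \<le> T + 1"
      using \<open>t N \<le> T + 1\<close> before[of n] that by (cases "n = N") auto
    then have "\<epsilon> * t n \<le> \<epsilon> * (T + 1)" using eps by simp
    also have "\<dots> = min c 1" using T by (simp add: \<epsilon>_def)
    finally show ?thesis .
  qed
  have S2: "S n \<le> E + 2" if "n \<le> N" for n
    using S[of n] small[OF that] by simp
  have "(E + 3) / c < ln (1 + t N)"
  proof -
    have "ln T < ln (1 + t N)" using N T by simp
    then show ?thesis by (simp add: T_def)
  qed
  then have "S N < c * ln (1 + t N)"
    using S2[of N] c by (simp add: field_simps)
  then obtain k where k: "k < N" "(norm (pair_g (z k)))\<^sup>2 < c / (1 + t k)"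
    using logarithmic_pigeonhole[where h = h and N = N, OF h(1) c, where q = "\<lambda>k. (norm (pair_g (z k)))\<^sup>2"]
    unfolding S_def t_def by blast
  define r where "r = sqrt (1 + t k)"
  have r: "1 \<le> r" "r\<^sup>2 = 1 + t k" using t[of k] by (simp_all add: r_def)
  have disp: "norm (z k - (a, b)) \<le> r * (E + 3) / 2"
  proof -
    have "norm (z k - (a, b)) \<le> (t k / r + r * S k) / 2"
      using scheme_displacement[where z = z and h = h and G = "\<lambda>n. pair_g (z n)" and a = r and n = k]
        h zS r(1) by (simp add: t_def S_def z0)
    moreover have "t k / r \<le> r"
      using r by (simp add: divide_le_eq flip: power2_eq_square)
    moreover have "r * S k \<le> r * (E + 2)"
      using r(1) S2[of k] k(1) by simp
    ultimately show ?thesis by (simp add: algebra_simps)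
  qed
  have dist: "norm (fst (z k) - snd (z k)) \<le> r * (norm (a - b) + E + 3)"
  proof -
    have "norm (fst (z k) - snd (z k)) \<le> norm (a - b) + norm (fst (z k) - a) + norm (snd (z k) - b)"
      using dist_triangle[of "fst (z k)" "snd (z k)" a] dist_triangle[of a "snd (z k)" b]
      by (simp add: dist_norm norm_minus_commute)
    moreover have "norm (fst (z k) - a) \<le> norm (z k - (a, b))"
      "norm (snd (z k) - b) \<le> norm (z k - (a, b))"
      using norm_fst_le[of "fst (z k) - a" "snd (z k) - b"] norm_snd_le[of "snd (z k) - b" "fst (z k) - a"]
      by (simp_all add: minus_prod_def)
    moreover have "norm (a - b) \<le> r * norm (a - b)"
      using r(1) mult_right_mono[of 1 r "norm (a - b)"] by simp
    ultimately show ?thesis using disp by (simp add: algebra_simps)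
  qed
  have "defect u v (z k) \<le> sqrt (c / (1 + t k)) * norm (fst (z k) - snd (z k))"
  proof -
    have "(norm (g (fst (z k))))\<^sup>2 \<le> c / (1 + t k)" "(norm (g (snd (z k))))\<^sup>2 \<le> c / (1 + t k)"
      using k(2) unfolding norm_pair_g
      by (smt (verit) zero_le_power2)+
    from defect_le_slope_times_distance[OF uv this] show ?thesis by simp
  qed
  also have "\<dots> \<le> sqrt (c / (1 + t k)) * (r * (norm (a - b) + E + 3))"
    using c t[of k] by (intro mult_left_mono dist) simp
  also have "\<dots> = sqrt c * (norm (a - b) + E + 3)"
    using r by (simp add: real_sqrt_divide flip: r_def)
  finally have "defect u v (z k) \<le> sqrt c * (norm (a - b) + E + 3)" .
  then show ?thesis using D[of k] small[of k] k(1) by (simp add: E_def)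
qed

lemma convex_potential: "convex_on UNIV \<psi>"
proof -
  have "\<psi> (u *\<^sub>R a + v *\<^sub>R b) \<le> u * \<psi> a + v * \<psi> b"
    if uv: "0 \<le> u" "0 \<le> v" "u + v = 1" for a b u v
  proof -
    define C where "C = norm (a - b) + (\<psi> a + \<psi> b - 2 * m) + 3"
    have "((\<lambda>c. sqrt c * C + 2 * c) \<longlongrightarrow> sqrt 0 * C + 2 * 0) (at_right 0)"
      by (intro tendsto_intros)
    moreover have "\<forall>\<^sub>F c in at_right 0. defect u v (a, b) \<le> sqrt c * C + 2 * c"
      using defect_bound[OF uv] unfolding C_def by (auto simp: eventually_at_filter)
    ultimately have "defect u v (a, b) \<le> sqrt 0 * C + 2 * 0"
      by (rule tendsto_lowerbound) simp
    then show ?thesis by (simp add: defect_def)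
  qed
  then show ?thesis unfolding convex_on_def by simp
qed

end

theorem corollary3p17:
  fixes \<psi> :: "'a::{real_inner, complete_space} \<Rightarrow> real"
  assumes "C2 \<psi>"
    and "bdd_below (range \<psi>)"
    and "convex_on UNIV (\<lambda>x. (1/2) * (norm (grad \<psi> x))\<^sup>2)"
  shows "convex_on UNIV \<psi>"
proof -
  obtain m where "\<And>x. m \<le> \<psi> x"
    using assms(2) unfolding bdd_below_def by blast
  then interpret convex_slope_potential \<psi> "grad \<psi>" m
    using C2_GDERIV_grad[OF assms(1)] assms(3) by unfold_locales auto
  show ?thesis by (rule convex_potential)
qed

end
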